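(* Let $(D,\dashv,\vdash,\alpha,\beta)$ be a BiHom-associative dialgebra and let $R:D\to D$ be a Rota-Baxter operator of weight $0$ on $D$, i.e. $R$ is linear, $\alpha\circ R=R\circ\alpha$, $\beta\circ R=R\circ\beta$, and for all $x,y\in D$ $$R(x)\dashv R(y)=R(R(x)\dashv y+x\dashv R(y)),\qquad R(x)\vdash R(y)=R(R(x)\vdash y+x\vdash R(y)).$$ Then $(D,\triangleleft,\triangleright,\alpha,\beta)$ is a BiHom-associative dialgebra, where for all $x,y\in D$ $$x\triangleleft y=R(x)\dashv y+x\dashv R(y),\qquad x\triangleright y=R(x)\vdash y+x\vdash R(y).$$
   Context: All vector spaces are over a fixed field. A BiHom-associative dialgebra is a tuple $(A,\dashv,\vdash,\alpha,\beta)$ consisting of a vector space $A$, bilinear maps $\dashv,\vdash:A\times A\to A$ and linear maps $\alpha,\beta:A\to A$ such that $\alpha\circ\beta=\beta\circ\alpha$ and, for all $x,y,z\in A$: (i) $(x\dashv y)\dashv\beta(z)=\alpha(x)\dashv(y\dashv z)$; (ii) $(x\dashv y)\dashv\beta(z)=\alpha(x)\dashv(y\vdash z)$; (iii) $(x\vdash y)\dashv\beta(z)=\alpha(x)\vdash(y\dashv z)$; (iv) $(x\dashv y)\vdash\beta(z)=\alpha(x)\vdash(y\vdash z)$; (v) $(x\vdash y)\vdash\beta(z)=\alpha(x)\vdash(y\vdash z)$. *)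

theory Defs
  imports Complex_Main
begin

text \<open>
  A vector space is a type \<^typ>\<open>'v\<close> of class \<^class>\<open>ab_group_add\<close> with a scalar multiplication
  over an arbitrary field \<^typ>\<open>'k\<close> satisfying \<^const>\<open>vector_space\<close>.  The library's
  bilinearity predicate covers real vector spaces only.
\<close>

definition bilinear_over ::
  "('k::field \<Rightarrow> 'v::ab_group_add \<Rightarrow> 'v) \<Rightarrow> ('v \<Rightarrow> 'v \<Rightarrow> 'v) \<Rightarrow> bool" where
  "bilinear_over scale f \<longleftrightarrow>
     (\<forall>x. Vector_Spaces.linear scale scale (\<lambda>y. f x y)) \<and>
     (\<forall>y. Vector_Spaces.linear scale scale (\<lambda>x. f x y))"

text \<open>No multiplicativity of \<open>\<alpha>\<close> and \<open>\<beta>\<close> with respect to the products is required.\<close>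

locale bihom_associative_dialgebra = vector_space scale
  for scale :: "'k::field \<Rightarrow> 'v::ab_group_add \<Rightarrow> 'v" +
  fixes left :: "'v \<Rightarrow> 'v \<Rightarrow> 'v" (infixl "\<stileturn>" 70)
    and right :: "'v \<Rightarrow> 'v \<Rightarrow> 'v" (infixl "\<turnstile>" 70)
    and \<alpha> :: "'v \<Rightarrow> 'v"
    and \<beta> :: "'v \<Rightarrow> 'v"
  assumes bilinear_left: "bilinear_over scale (\<stileturn>)"
    and bilinear_right: "bilinear_over scale (\<turnstile>)"
    and linear_alpha: "Vector_Spaces.linear scale scale \<alpha>"
    and linear_beta: "Vector_Spaces.linear scale scale \<beta>"
    and alpha_beta_commute: "\<alpha> \<circ> \<beta> = \<beta> \<circ> \<alpha>"
    and left_left_left: "(x \<stileturn> y) \<stileturn> \<beta> z = \<alpha> x \<stileturn> (y \<stileturn> z)"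
    and left_left_right: "(x \<stileturn> y) \<stileturn> \<beta> z = \<alpha> x \<stileturn> (y \<turnstile> z)"
    and right_left: "(x \<turnstile> y) \<stileturn> \<beta> z = \<alpha> x \<turnstile> (y \<stileturn> z)"
    and left_right: "(x \<stileturn> y) \<turnstile> \<beta> z = \<alpha> x \<turnstile> (y \<turnstile> z)"
    and right_right: "(x \<turnstile> y) \<turnstile> \<beta> z = \<alpha> x \<turnstile> (y \<turnstile> z)"

locale rota_baxter_operator_weight_0 =
  bihom_associative_dialgebra scale left right \<alpha> \<beta>
  for scale :: "'k::field \<Rightarrow> 'v::ab_group_add \<Rightarrow> 'v"
    and left :: "'v \<Rightarrow> 'v \<Rightarrow> 'v" (infixl "\<stileturn>" 70)
    and right :: "'v \<Rightarrow> 'v \<Rightarrow> 'v" (infixl "\<turnstile>" 70)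
    and \<alpha> :: "'v \<Rightarrow> 'v"
    and \<beta> :: "'v \<Rightarrow> 'v" +
  fixes R :: "'v \<Rightarrow> 'v"
  assumes linear_R: "Vector_Spaces.linear scale scale R"
    and alpha_R_commute: "\<alpha> \<circ> R = R \<circ> \<alpha>"
    and beta_R_commute: "\<beta> \<circ> R = R \<circ> \<beta>"
    and rota_baxter_left: "R x \<stileturn> R y = R (R x \<stileturn> y + x \<stileturn> R y)"
    and rota_baxter_right: "R x \<turnstile> R y = R (R x \<turnstile> y + x \<turnstile> R y)"

text \<open>
  Applied to \<open>\<stileturn>\<close> and \<open>\<turnstile>\<close> this gives the products \<open>\<triangleleft>\<close> and \<open>\<triangleright>\<close>, respectively.
\<close>

definition rb_product ::
  "('v \<Rightarrow> 'v) \<Rightarrow> ('v \<Rightarrow> 'v \<Rightarrow> 'v) \<Rightarrow> 'v \<Rightarrow> 'v \<Rightarrow> 'v::ab_group_add" where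
  "rb_product R f x y = f (R x) y + f x (R y)"

end

theory Submission
  imports Defs
begin

text \<open>
  The five axioms all have the shape
  \<open>f (g x y) (\<beta> z) = h (\<alpha> x) (k y z)\<close>, where each of \<open>f, g, h, k\<close> is one of the two products.
  Passing from \<open>f\<close> to \<open>(x, y) \<mapsto> f (R x) y + f x (R y)\<close> preserves every identity of this shape: since
  the Rota-Baxter identity says that \<open>R\<close> sends the new products \<open>g\<close> and \<open>k\<close> of \<open>x\<close> and \<open>y\<close> to the
  old ones of \<open>R x\<close> and \<open>R y\<close>, and \<open>R\<close> commutes with \<open>\<alpha>\<close> and \<open>\<beta>\<close>, both sides expand into the three
  instances of the old identity in which \<open>R\<close> is applied to exactly two of \<open>x, y, z\<close>.
  Only additivity of \<open>f\<close> in its first and of \<open>h\<close> in its second argument is needed.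
\<close>

lemma rb_product_bihom_associative:
  fixes f g h k :: "'v::ab_group_add \<Rightarrow> 'v \<Rightarrow> 'v" and R \<alpha> \<beta> :: "'v \<Rightarrow> 'v"
  assumes add_f: "\<And>u v w. f (u + v) w = f u w + f v w"
    and add_h: "\<And>u v w. h u (v + w) = h u v + h u w"
    and rota_baxter_g: "\<And>u v. g (R u) (R v) = R (g (R u) v + g u (R v))"
    and rota_baxter_k: "\<And>u v. k (R u) (R v) = R (k (R u) v + k u (R v))"
    and R_\<alpha>: "\<And>u. R (\<alpha> u) = \<alpha> (R u)"
    and R_\<beta>: "\<And>u. R (\<beta> u) = \<beta> (R u)"
    and assoc: "\<And>u v w. f (g u v) (\<beta> w) = h (\<alpha> u) (k v w)"
  shows "rb_product R f (rb_product R g x y) (\<beta> z) =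
         rb_product R h (\<alpha> x) (rb_product R k y z)"
proof -
  have "rb_product R f (rb_product R g x y) (\<beta> z)
      = f (g (R x) (R y)) (\<beta> z) + f (g (R x) y) (\<beta> (R z)) + f (g x (R y)) (\<beta> (R z))"
    by (simp add: rb_product_def add_f R_\<beta> rota_baxter_g[symmetric] add.assoc)
  also have "\<dots> = h (\<alpha> (R x)) (k (R y) z) + h (\<alpha> (R x)) (k y (R z)) + h (\<alpha> x) (k (R y) (R z))"
    by (simp only: assoc)
  also have "\<dots> = rb_product R h (\<alpha> x) (rb_product R k y z)"
    by (simp add: rb_product_def add_h R_\<alpha> rota_baxter_k[symmetric])
  finally show ?thesis .
qed

lemma bilinear_over_add_left:
  assumes "bilinear_over scale f"
  shows "f (x + y) z = f x z + f y z"
proof -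
  interpret Vector_Spaces.linear scale scale "\<lambda>x. f x z"
    using assms by (simp add: bilinear_over_def)
  show ?thesis by (rule add)
qed

lemma bilinear_over_add_right:
  assumes "bilinear_over scale f"
  shows "f x (y + z) = f x y + f x z"
proof -
  interpret Vector_Spaces.linear scale scale "f x"
    using assms by (simp add: bilinear_over_def)
  show ?thesis by (rule add)
qed

lemma bilinear_over_rb_product:
  assumes R: "Vector_Spaces.linear scale scale R" and f: "bilinear_over scale f"
  shows "bilinear_over scale (rb_product R f)"
proof -
  interpret R: Vector_Spaces.linear scale scale R by (rule R)
  interpret vector_space_pair scale scale by unfold_locales
  have f1: "Vector_Spaces.linear scale scale (\<lambda>x. f x y)"
    and f2: "Vector_Spaces.linear scale scale (f x)" for x y
    using f by (simp_all add: bilinear_over_def)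
  show ?thesis
    unfolding bilinear_over_def rb_product_def
    using linear_compose_add[OF f2 Vector_Spaces.linear_compose[OF R f2]]
      linear_compose_add[OF Vector_Spaces.linear_compose[OF R f1] f1]
    by (simp add: o_def)
qed

theorem proposition2p18:
  fixes scale :: "'k::field \<Rightarrow> 'v::ab_group_add \<Rightarrow> 'v"
    and left right :: "'v \<Rightarrow> 'v \<Rightarrow> 'v"
    and \<alpha> \<beta> R :: "'v \<Rightarrow> 'v"
  assumes "bihom_associative_dialgebra scale left right \<alpha> \<beta>"
    and "rota_baxter_operator_weight_0 scale left right \<alpha> \<beta> R"
  shows "bihom_associative_dialgebra scale (rb_product R left) (rb_product R right) \<alpha> \<beta>"
proof -
  interpret rota_baxter_operator_weight_0 scale left right \<alpha> \<beta> R by (rule assms(2))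
  have R_\<alpha>: "R (\<alpha> u) = \<alpha> (R u)" and R_\<beta>: "R (\<beta> u) = \<beta> (R u)" for u
    using alpha_R_commute beta_R_commute by (simp_all add: fun_eq_iff)
  note add_left = bilinear_over_add_left[OF bilinear_left] bilinear_over_add_left[OF bilinear_right]
  note add_right = bilinear_over_add_right[OF bilinear_left] bilinear_over_add_right[OF bilinear_right]
  note transfer = rb_product_bihom_associative[where R = R and \<alpha> = \<alpha> and \<beta> = \<beta>]
  note facts = add_left add_right rota_baxter_left rota_baxter_right R_\<alpha> R_\<beta>
  show ?thesis
  proof (intro bihom_associative_dialgebra.intro[OF vector_space_axioms]
      bihom_associative_dialgebra_axioms.intro)
    show "bilinear_over scale (rb_product R left)" "bilinear_over scale (rb_product R right)"
      by (rule bilinear_over_rb_product[OF linear_R bilinear_left]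
          bilinear_over_rb_product[OF linear_R bilinear_right])+
    show "Vector_Spaces.linear scale scale \<alpha>" "Vector_Spaces.linear scale scale \<beta>"
      by (fact linear_alpha linear_beta)+
    show "\<alpha> \<circ> \<beta> = \<beta> \<circ> \<alpha>" by (fact alpha_beta_commute)
    fix x y z
    show "rb_product R left (rb_product R left x y) (\<beta> z)
        = rb_product R left (\<alpha> x) (rb_product R left y z)"
      by (rule transfer; fact facts left_left_left)
    show "rb_product R left (rb_product R left x y) (\<beta> z)
        = rb_product R left (\<alpha> x) (rb_product R right y z)"
      by (rule transfer; fact facts left_left_right)
    show "rb_product R left (rb_product R right x y) (\<beta> z)
        = rb_product R right (\<alpha> x) (rb_product R left y z)"
      by (rule transfer; fact facts right_left)
    show "rb_product R right (rb_product R left x y) (\<beta> z)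
        = rb_product R right (\<alpha> x) (rb_product R right y z)"
      by (rule transfer; fact facts left_right)
    show "rb_product R right (rb_product R right x y) (\<beta> z)
        = rb_product R right (\<alpha> x) (rb_product R right y z)"
      by (rule transfer; fact facts right_right)
  qed
qed

end
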